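(* Let $k$ be a finite field with $q$ elements, let $\alpha\ge 0$ be a fixed integer, and let $\mu$ be a fixed probability distribution on $k$ with $\|\widehat\mu\|_1<q^{1/2}$. For each $m\ge 0$ let $x_0,\ldots,x_{2m+\alpha}$ be chosen independently from the distribution $\mu$. Then, as $m\to\infty$, the probability that $(x_0,\ldots,x_{2m+\alpha})\in H_m$ approaches $q^{-(\alpha+1)}$. In particular (case $\alpha=0$), if the $2m+1$ entries $x_0,\ldots,x_{2m}$ of the square Hankel matrix $(x_{i+j})_{0\le i,j\le m}$ of order $m+1$ are chosen independently from $\mu$, then as $m\to\infty$ the matrix is singular with probability approaching $1/q$.
   Context: For integers $m,n$ with $0\le 2m\le n+1$, $H_m\subseteq k^{n+1}$ is the set of sequences $(x_0,\ldots,x_n)$ for which there exist $a_0,\ldots,a_m\in k$, not all zero, such that $\sum_{i=0}^m a_ix_{i+j}=0$ for each $j=0,1,\ldots,n-m$ (here $n=2m+\alpha$). A distribution on $k$ is a function $\mu:k\to\mathbf{R}$ with $\mu(x)\ge 0$ for all $x\in k$ and $\sum_{x\in k}\mu(x)=1$. Fix a nontrivial homomorphism $\psi_0$ from the additive group of $k$ to the unit circle in $\mathbf{C}$. The Fourier transform of $\mu$ is $\widehat\mu(a)=\sum_{x\in k}\mu(x)\psi_0(ax)$ for $a\in k$, and $\|\widehat\mu\|_1=\sum_{a\in k}|\widehat\mu(a)|$. *)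

theory Defs
  imports "HOL-Probability.Probability" "Jordan_Normal_Form.Determinant"
begin

definition nontrivial_character :: "('a::field \<Rightarrow> complex) \<Rightarrow> bool" where
  "nontrivial_character \<psi> \<longleftrightarrow>
     (\<forall>x y. \<psi> (x + y) = \<psi> x * \<psi> y) \<and> (\<forall>x. norm (\<psi> x) = 1) \<and> (\<exists>x. \<psi> x \<noteq> 1)"

definition fourier :: "('a::{field,finite} \<Rightarrow> complex) \<Rightarrow> 'a pmf \<Rightarrow> 'a \<Rightarrow> complex" where
  "fourier \<psi> \<mu> a = (\<Sum>x\<in>UNIV. complex_of_real (pmf \<mu> x) * \<psi> (a * x))"

definition fourier_norm1 :: "('a::{field,finite} \<Rightarrow> complex) \<Rightarrow> 'a pmf \<Rightarrow> real" where
  "fourier_norm1 \<psi> \<mu> = (\<Sum>a\<in>UNIV. norm (fourier \<psi> \<mu> a))"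

text \<open>A sequence \<open>(x\<^sub>0, \<dots>, x\<^sub>n)\<close> is a function on \<open>{..n}\<close>, taking the value
  \<^const>\<open>undefined\<close> elsewhere.  The definition is meant for
  \<open>2 * m \<le> n + 1\<close>, where \<open>m \<le> n\<close> and so \<open>n - m\<close> is not truncated.\<close>

definition hankel_set :: "nat \<Rightarrow> nat \<Rightarrow> (nat \<Rightarrow> 'a::field) set" where
  "hankel_set m n =
     {x \<in> {..n} \<rightarrow>\<^sub>E UNIV. \<exists>a. (\<exists>i\<le>m. a i \<noteq> 0) \<and> (\<forall>j\<le>n - m. (\<Sum>i\<le>m. a i * x (i + j)) = 0)}"

definition iid_pmf :: "'a pmf \<Rightarrow> nat \<Rightarrow> (nat \<Rightarrow> 'a) pmf" where
  "iid_pmf \<mu> n = Pi_pmf {..n} undefined (\<lambda>_. \<mu>)"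

definition hankel_mat :: "nat \<Rightarrow> (nat \<Rightarrow> 'a) \<Rightarrow> 'a mat" where
  "hankel_mat m x = mat (m + 1) (m + 1) (\<lambda>(i, j). x (i + j))"

end

theory Submission
  imports Defs "HOL-Computational_Algebra.Polynomial_Factorial"
begin

text \<open>
  With \<open>n = 2 m + \<alpha>\<close>, let \<open>A\<^sub>m(x)\<close> be the space of polynomials \<open>f\<close> of degree at most \<open>m\<close> whose
  coefficients satisfy \<open>\<Sum>i\<le>m. f\<^sub>i x(i + j) = 0\<close> for \<open>j \<le> n - m\<close>; then \<open>x \<in> H\<^sub>m\<close> iff \<open>A\<^sub>m(x) \<noteq> 0\<close>, and in that
  case \<open>A\<^sub>m\<^sub>-\<^sub>1(x)\<close> has codimension one in \<open>A\<^sub>m(x)\<close>. Hence \<open>(q - 1) 1\<^bsub>H\<^esub> = |A\<^sub>m| - q |A\<^sub>m\<^sub>-\<^sub>1| + q - 1\<close>, and only the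
  expectation of \<open>|A\<^sub>m|\<close> matters. By orthogonality of characters it equals
  \<open>q\<^sup>-\<^sup>(\<^sup>n\<^sup>-\<^sup>m\<^sup>+\<^sup>1\<^sup>)\<close> times the sum, over \<open>g\<close> of degree at most \<open>m\<close> and \<open>b\<close> of degree at most \<open>n - m\<close>,
  of the product over \<open>k\<close> of the Fourier transform of \<open>\<mu>\<close> at the \<open>k\<close>-th coefficient of \<open>g b\<close>. The
  pairs with \<open>g b = 0\<close> give the main term. A nonzero polynomial \<open>h\<close> is hit by at most as many pairs as
  it has divisors, which is subexponential in \<open>n\<close>, so the rest is at most
  \<open>e\<^sup>o\<^sup>(\<^sup>n\<^sup>)\<close> times the \<open>(n + 1)\<close>-st power of the norm, and this is \<open>o(q\<^sup>m)\<close>.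
\<close>

hide_const (open) Module.smult
unbundle no vec_syntax

section \<open>Polynomials of bounded degree over a finite coefficient type\<close>

lemma bij_betw_coeff_PiE:
  "bij_betw (\<lambda>p::'a::zero poly. restrict (coeff p) {..d}) {p. degree p \<le> d} ({..d} \<rightarrow>\<^sub>E UNIV)"
proof (rule bij_betwI')
  fix p r :: "'a poly" assume "p \<in> {p. degree p \<le> d}" "r \<in> {p. degree p \<le> d}"
  then have deg: "coeff p k = coeff r k" if "k > d" for k
    using that by (auto simp: coeff_eq_0)
  have "p = r" if eq: "restrict (coeff p) {..d} = restrict (coeff r) {..d}"
  proof (rule poly_eqI)
    fix k show "coeff p k = coeff r k"
      using deg[of k] fun_cong[OF eq, of k] by (cases "k \<le> d") auto
  qed
  then show "(restrict (coeff p) {..d} = restrict (coeff r) {..d}) = (p = r)" by auto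
next
  fix c :: "nat \<Rightarrow> 'a" assume c: "c \<in> {..d} \<rightarrow>\<^sub>E UNIV"
  let ?p = "Abs_poly (\<lambda>k. if k \<le> d then c k else 0)"
  have co: "coeff ?p k = (if k \<le> d then c k else 0)" for k
    by (subst coeff_Abs_poly[where n = d]) auto
  have "degree ?p \<le> d"
    by (rule degree_le) (simp add: co)
  moreover have "c = restrict (coeff ?p) {..d}"
    using c by (auto simp: co fun_eq_iff PiE_def extensional_def)
  ultimately show "\<exists>p\<in>{p. degree p \<le> d}. c = restrict (coeff p) {..d}" by blast
qed auto

lemma finite_degree_le: "finite {p::'a::{zero,finite} poly. degree p \<le> d}"
  using bij_betw_finite[OF bij_betw_coeff_PiE[where 'a = 'a and d = d]]
  by (simp add: finite_PiE)

text \<open>The coefficients up to \<open>d\<close> range independently, so the sum factors by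
  distributivity. This serves to count polynomials, to detect annihilators by characters, and to
  recognise a power of \<open>fourier_norm1\<close>.\<close>

lemma sum_degree_le_prod_coeff:
  fixes F :: "nat \<Rightarrow> 'a::{zero,finite} \<Rightarrow> 'b::comm_semiring_1"
  shows "(\<Sum>p | degree p \<le> d. \<Prod>k\<le>d. F k (coeff p k)) = (\<Prod>k\<le>d. \<Sum>a\<in>UNIV. F k a)"
proof -
  have "(\<Sum>p | degree p \<le> d. \<Prod>k\<le>d. F k (coeff p k))
      = (\<Sum>p | degree p \<le> d. \<Prod>k\<le>d. F k (restrict (coeff p) {..d} k))"
    by (intro sum.cong prod.cong) auto
  also have "\<dots> = (\<Sum>c\<in>{..d} \<rightarrow>\<^sub>E UNIV. \<Prod>k\<le>d. F k (c k))"
    by (rule sum.reindex_bij_betw[OF bij_betw_coeff_PiE])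
  also have "\<dots> = (\<Prod>k\<le>d. \<Sum>a\<in>UNIV. F k a)"
    by (rule prod_sum_PiE[symmetric]) auto
  finally show ?thesis .
qed

lemma card_degree_le: "card {p::'a::{zero,finite} poly. degree p \<le> d} = CARD('a) ^ (d + 1)"
  using sum_degree_le_prod_coeff[where F = "\<lambda>_ _::'a. 1::nat" and d = d]
  by simp

section \<open>The divisor bound\<close>

lemma finite_poly_divisors:
  fixes h :: "'a::{field,finite} poly"
  assumes "h \<noteq> 0"
  shows "finite {g. g dvd h}"
  by (rule finite_subset[OF _ finite_degree_le[of "degree h"]]) (use assms in \<open>auto dest: dvd_imp_degree_le\<close>)

lemma irreducible_poly_degree_pos:
  fixes p :: "'a::field poly"
  assumes "irreducible p"
  shows "degree p > 0"
  using assms irreducible_not_unit[OF assms] is_unit_iff_degree[of p] by (auto simp: irreducible_def)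

text \<open>A nonconstant divisor of least degree cannot split into two nonconstant factors.\<close>

lemma exists_irreducible_poly_divisor:
  fixes h :: "'a::field poly"
  assumes "degree h > 0"
  obtains p where "irreducible p" "p dvd h"
proof -
  define P where "P = (\<lambda>p. degree p > 0 \<and> p dvd h)"
  have "P h" using assms by (simp add: P_def)
  then obtain p where p: "P p" "\<And>r. P r \<Longrightarrow> degree p \<le> degree r"
    using ex_has_least_nat[of P h degree] by auto
  have "irreducible p"
  proof (rule irreducibleI)
    show "p \<noteq> 0" using p(1) by (auto simp: P_def)
    show "\<not> is_unit p" using p(1) is_unit_iff_degree[OF \<open>p \<noteq> 0\<close>] by (simp add: P_def)
    fix a b assume ab: "p = a * b"
    with \<open>p \<noteq> 0\<close> have nz: "a \<noteq> 0" "b \<noteq> 0" by auto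
    have deg: "degree p = degree a + degree b" using ab nz by (simp add: degree_mult_eq)
    have "a dvd h" using p(1) ab by (auto simp: P_def dest: dvd_mult_left)
    then have "degree a = 0 \<or> degree b = 0"
      using p(2)[of a] deg by (cases "degree a = 0") (auto simp: P_def)
    then show "is_unit a \<or> is_unit b"
      using nz is_unit_iff_degree by blast
  qed
  with p(1) that show thesis by (auto simp: P_def)
qed

text \<open>Induction on \<open>e\<close>. If \<open>p\<close> divides \<open>g\<close>, one factor
  \<open>p\<close> cancels; otherwise primality of \<open>p\<close> forces \<open>p ^ Suc e\<close>
  into the cofactor of \<open>g\<close>, and then \<open>g\<close> divides \<open>r\<close>.\<close>

lemma poly_divisor_irreducible_power_mult:
  fixes p :: "'a::field poly"
  assumes p: "irreducible p" and "g dvd p ^ e * r"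
  shows "\<exists>j\<le>e. \<exists>s. s dvd r \<and> g = p ^ j * s"
  using assms(2)
proof (induction e arbitrary: g)
  case 0
  then show ?case by auto
next
  case (Suc e)
  have "p \<noteq> 0" using p by auto
  have pe: "prime_elem p" using p by (rule field_poly_irreducible_imp_prime)
  show ?case
  proof (cases "p dvd g")
    case True
    then obtain g' where g: "g = p * g'" by auto
    with Suc.prems \<open>p \<noteq> 0\<close> have "g' dvd p ^ e * r" by (simp add: mult.assoc)
    from Suc.IH[OF this] obtain j s where "j \<le> e" "s dvd r" "g' = p ^ j * s" by auto
    then show ?thesis
      using g by (intro exI[of _ "Suc j"] conjI exI[of _ s]) (auto simp: mult.assoc)
  next
    case False
    from Suc.prems obtain k where k: "p ^ Suc e * r = g * k" by (elim dvdE)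
    then have "p ^ Suc e dvd g * k" by (metis dvd_triv_left)
    then have "p ^ Suc e dvd k"
      using prime_power_dvd_multD[OF pe, of "Suc e" g k] False by simp
    then obtain k' where "k = p ^ Suc e * k'" by (elim dvdE)
    then have "p ^ Suc e * r = p ^ Suc e * (g * k')" using k by (simp only: mult_ac)
    then have "r = g * k'" using \<open>p \<noteq> 0\<close> by simp
    then show ?thesis by (intro exI[of _ 0]) auto
  qed
qed

lemma card_poly_divisors_irreducible_power_mult:
  fixes p :: "'a::{field,finite} poly"
  assumes p: "irreducible p" and "r \<noteq> 0"
  shows "card {g. g dvd p ^ e * r} \<le> (e + 1) * card {s. s dvd r}"
proof -
  let ?S = "{..e} \<times> {s. s dvd r}"
  have fin: "finite ?S" using finite_poly_divisors[OF \<open>r \<noteq> 0\<close>] by simp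
  have "{g. g dvd p ^ e * r} \<subseteq> (\<lambda>(j, s). p ^ j * s) ` ?S"
  proof
    fix g assume "g \<in> {g. g dvd p ^ e * r}"
    then obtain j s where "j \<le> e" "s dvd r" "g = p ^ j * s"
      using poly_divisor_irreducible_power_mult[OF p] by blast
    then show "g \<in> (\<lambda>(j, s). p ^ j * s) ` ?S" by (intro image_eqI[of _ _ "(j, s)"]) auto
  qed
  then have "card {g. g dvd p ^ e * r} \<le> card ?S"
    using fin by (rule surj_card_le[rotated])
  then show ?thesis by (simp add: card_cartesian_product)
qed

text \<open>The exponents of powers of \<open>p\<close> dividing \<open>h\<close> are bounded by
  \<open>degree h\<close>, since \<open>degree p > 0\<close>; the largest one works.\<close>

lemma obtain_irreducible_power_cofactor:
  fixes p h :: "'a::field poly"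
  assumes p: "irreducible p" and "h \<noteq> 0"
  obtains e r where "h = p ^ e * r" "\<not> p dvd r"
proof -
  have bnd: "e \<le> degree h" if "p ^ e dvd h" for e
  proof -
    have "degree (p ^ e) \<le> degree h" using dvd_imp_degree_le[OF that \<open>h \<noteq> 0\<close>] .
    moreover have "degree (p ^ e) = e * degree p" using p by (intro degree_power_eq) auto
    moreover have "degree p > 0" using p by (rule irreducible_poly_degree_pos)
    ultimately show ?thesis
      by (metis One_nat_def Suc_leI le_trans mult.right_neutral mult_le_mono2)
  qed
  have "p ^ 0 dvd h" by simp
  from GreatestI_nat[of "\<lambda>e. p ^ e dvd h", OF this bnd]
    Greatest_le_nat[of "\<lambda>e. p ^ e dvd h", OF _ bnd]
  obtain e where e: "p ^ e dvd h" "\<And>e'. p ^ e' dvd h \<Longrightarrow> e' \<le> e" by blast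
  from e(1) obtain r where r: "h = p ^ e * r" by (elim dvdE)
  have "\<not> p dvd r"
  proof
    assume "p dvd r"
    then have "p ^ Suc e dvd h" unfolding r by (simp add: mult.commute mult_dvd_mono)
    from e(2)[OF this] show False by simp
  qed
  with r that show thesis by blast
qed

text \<open>Splitting off \<open>p ^ e\<close> costs a factor \<open>e + 1\<close> in the divisor
  count. For \<open>p\<close> of large degree the growth of \<open>u ^ degree h\<close> absorbs it;
  for \<open>p\<close> of small degree it costs an additional constant \<open>B\<close>, but there
  are only finitely many such \<open>p\<close>.\<close>

lemma card_poly_divisors_bound:
  fixes \<epsilon> :: real
  assumes "\<epsilon> > 0"
  obtains C where "C \<ge> 0"
    and "\<And>h::'a::{field,finite} poly. h \<noteq> 0 \<Longrightarrow> real (card {g. g dvd h}) \<le> C * (1 + \<epsilon>) ^ degree h"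
proof -
  define u where "u = 1 + \<epsilon>"
  have u: "u > 1" using assms by (simp add: u_def)
  \<comment> \<open>\<open>D\<close> separates small from large degrees: if \<open>degree p\<close>
    is at least \<open>D\<close>, then
    \<open>e + 1 \<le> 2 ^ e \<le> u ^ (e * degree p)\<close>.\<close>
  obtain D where D: "2 < u ^ D" using real_arch_pow[OF u] by blast
  define B where "B = 1 + 1 / \<epsilon>"
  have B: "B \<ge> 1" using assms by (simp add: B_def)
  have small: "real e + 1 \<le> B * u ^ e" for e
  proof -
    have "real e + 1 \<le> (1 + 1 / \<epsilon>) * (1 + real e * \<epsilon>)"
      using assms by (simp add: algebra_simps)
    also have "\<dots> \<le> B * u ^ e"
      unfolding B_def u_def using assms Bernoulli_inequality[of \<epsilon> e]
      by (intro mult_left_mono) auto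
    finally show ?thesis .
  qed
  define S where "S = (\<lambda>h::'a poly. {p. irreducible p \<and> p dvd h \<and> degree p < D})"
  have finS: "finite (S h)" for h
    by (rule finite_subset[OF _ finite_degree_le[of D]]) (auto simp: S_def)
  have main: "real (card {g. g dvd h}) \<le> real CARD('a) * B ^ card (S h) * u ^ degree h"
    if "h \<noteq> 0" for h :: "'a poly"
    using that
  proof (induction "degree h" arbitrary: h rule: less_induct)
    case less
    show ?case
    proof (cases "degree h = 0")
      case True
      have "{g. g dvd h} \<subseteq> {g. degree g \<le> 0}"
        using dvd_imp_degree_le[OF _ less.prems] True by fastforce
      then have "card {g. g dvd h} \<le> CARD('a)"
        using card_mono[OF finite_degree_le[where 'a = 'a and d = 0]] card_degree_le[where 'a = 'a and d = 0]
        by simp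
      moreover have "1 \<le> B ^ card (S h)" using B by simp
      ultimately have "real (card {g. g dvd h}) * 1 \<le> real CARD('a) * B ^ card (S h)"
        by (intro mult_mono) auto
      then show ?thesis using True by simp
    next
      case False
      then obtain p where p: "irreducible p" "p dvd h"
        using exists_irreducible_poly_divisor[of h] by auto
      obtain e r where h: "h = p ^ e * r" and r: "\<not> p dvd r"
        using obtain_irreducible_power_cofactor[OF p(1) less.prems] .
      have nz: "r \<noteq> 0" "p \<noteq> 0" using less.prems h p(1) by auto
      have degp: "degree p > 0" using p(1) by (rule irreducible_poly_degree_pos)
      have "e \<noteq> 0" using p(2) h r by (cases e) auto
      have degh: "degree h = e * degree p + degree r"
        using nz by (simp add: h degree_mult_eq degree_power_eq)
      have IH: "real (card {g. g dvd r}) \<le> real CARD('a) * B ^ card (S r) * u ^ degree r"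
        by (rule less.hyps) (use \<open>e \<noteq> 0\<close> degp nz degh in auto)
      \<comment> \<open>As \<open>p\<close> does not divide \<open>r\<close>, it is missing from
        \<open>S r\<close>; when \<open>degree p < D\<close> it lies in \<open>S h\<close>, and this
        extra element pays for one factor \<open>B\<close>.\<close>
      have sub: "S r \<subseteq> S h - {p}" using r by (auto simp: S_def h)
      have "(real e + 1) * B ^ card (S r) \<le> B ^ card (S h) * u ^ (e * degree p)"
      proof (cases "degree p < D")
        case True
        then have "p \<in> S h" using p by (simp add: S_def)
        then have "card (S h) = Suc (card (S h - {p}))"
          using finS by (metis card.remove)
        then have "B ^ Suc (card (S r)) \<le> B ^ card (S h)"
          using card_mono[OF _ sub] finS B by (intro power_increasing) auto
        moreover have "u ^ e \<le> u ^ (e * degree p)"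
          using u degp by (intro power_increasing) auto
        ultimately have "B ^ Suc (card (S r)) * u ^ e \<le> B ^ card (S h) * u ^ (e * degree p)"
          using u B by (intro mult_mono) auto
        moreover have "(real e + 1) * B ^ card (S r) \<le> B * u ^ e * B ^ card (S r)"
          using small[of e] B by (intro mult_right_mono) auto
        ultimately show ?thesis by (simp add: mult_ac)
      next
        case False
        have "real e + 1 \<le> 2 ^ e" using Bernoulli_inequality[of "1::real" e] by simp
        also have "\<dots> \<le> (u ^ D) ^ e" using D by (intro power_mono) auto
        also have "\<dots> \<le> u ^ (e * degree p)"
          unfolding power_mult[symmetric] using False u by (intro power_increasing) auto
        finally have "real e + 1 \<le> u ^ (e * degree p)" .
        moreover have "B ^ card (S r) \<le> B ^ card (S h)"
          using card_mono[OF finS, of "S r" h] sub B by (intro power_increasing) auto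
        ultimately have "(real e + 1) * B ^ card (S r) \<le> u ^ (e * degree p) * B ^ card (S h)"
          using B u by (intro mult_mono) auto
        then show ?thesis by (simp add: mult.commute)
      qed
      note step = this
      have "real (card {g. g dvd h}) \<le> real ((e + 1) * card {g. g dvd r})"
        unfolding h using card_poly_divisors_irreducible_power_mult[OF p(1) nz(1)] of_nat_le_iff by blast
      also have "\<dots> = (real e + 1) * real (card {g. g dvd r})" by (simp add: algebra_simps)
      also have "\<dots> \<le> (real e + 1) * (real CARD('a) * B ^ card (S r) * u ^ degree r)"
        using IH by (intro mult_left_mono) auto
      also have "\<dots> = ((real e + 1) * B ^ card (S r)) * (real CARD('a) * u ^ degree r)"
        by (simp add: mult_ac)
      also have "\<dots> \<le> (B ^ card (S h) * u ^ (e * degree p)) * (real CARD('a) * u ^ degree r)"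
        using step u by (intro mult_right_mono) auto
      also have "\<dots> = real CARD('a) * B ^ card (S h) * u ^ degree h"
        by (simp add: degh power_add mult_ac)
      finally show ?thesis .
    qed
  qed
  \<comment> \<open>A bound on \<open>card (S h)\<close> that is uniform in
    \<open>h\<close>.\<close>
  define K where "K = card {p::'a poly. degree p \<le> D}"
  show thesis
  proof (rule that)
    show "0 \<le> real CARD('a) * B ^ K" using B by simp
    fix h :: "'a poly" assume "h \<noteq> 0"
    have "card (S h) \<le> K"
      unfolding K_def by (rule card_mono[OF finite_degree_le]) (auto simp: S_def)
    then have "real CARD('a) * B ^ card (S h) * u ^ degree h \<le> real CARD('a) * B ^ K * u ^ degree h"
      using B u by (intro mult_right_mono mult_left_mono power_increasing) auto
    with main[OF \<open>h \<noteq> 0\<close>] show "real (card {g. g dvd h}) \<le> real CARD('a) * B ^ K * (1 + \<epsilon>) ^ degree h"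
      unfolding u_def by (rule order.trans)
  qed
qed

section \<open>Annihilators of a sequence\<close>

text \<open>This is the left kernel of the Hankel matrix with \<open>m + 1\<close> rows and
  \<open>N + 1\<close> columns. Writing its vectors as polynomials turns an index shift into
  multiplication by the variable.\<close>

definition annihilators :: "nat \<Rightarrow> nat \<Rightarrow> (nat \<Rightarrow> 'a::field) \<Rightarrow> 'a poly set" where
  "annihilators m N x = {f. degree f \<le> m \<and> (\<forall>j\<le>N. (\<Sum>i\<le>m. coeff f i * x (i + j)) = 0)}"

lemma zero_in_annihilators: "0 \<in> annihilators m N x"
  by (simp add: annihilators_def)

lemma annihilators_add:
  "f \<in> annihilators m N x \<Longrightarrow> g \<in> annihilators m N x \<Longrightarrow> f + g \<in> annihilators m N x"
  by (auto simp: annihilators_def degree_add_le distrib_right sum.distrib)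

lemma annihilators_smult:
  "f \<in> annihilators m N x \<Longrightarrow> smult c f \<in> annihilators m N x"
  by (auto simp: annihilators_def mult.assoc sum_distrib_left[symmetric]
      intro: order.trans[OF degree_smult_le])

lemma annihilators_diff:
  "f \<in> annihilators m N x \<Longrightarrow> g \<in> annihilators m N x \<Longrightarrow> f - g \<in> annihilators m N x"
  using annihilators_add[of f m N x "smult (-1) g"] annihilators_smult[of g m N x "-1"] by simp

text \<open>Multiplication by the variable shifts the equations by one index: the degree bound grows
  by one and one equation is lost.\<close>

lemma annihilators_pCons_0:
  assumes "f \<in> annihilators m (Suc N) x"
  shows "pCons 0 f \<in> annihilators (Suc m) N x"
proof -
  have "(\<Sum>i\<le>Suc m. coeff (pCons 0 f) i * x (i + j)) = 0" if "j \<le> N" for j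
    using assms that by (auto simp: annihilators_def sum.atMost_Suc_shift simp del: sum.atMost_Suc)
  then show ?thesis
    using assms by (auto simp: annihilators_def intro: order.trans[OF degree_pCons_le])
qed

text \<open>Cuts the smaller space out of the larger by two linear functionals. The last sum may run
  to \<open>Suc m\<close> because the top coefficient vanishes.\<close>

lemma annihilators_Suc_iff:
  "f \<in> annihilators m (Suc N) x \<longleftrightarrow>
     f \<in> annihilators (Suc m) N x \<and> coeff f (Suc m) = 0 \<and>
     (\<Sum>i\<le>Suc m. coeff f i * x (i + Suc N)) = 0"
proof -
  have "degree f \<le> m \<longleftrightarrow> degree f \<le> Suc m \<and> coeff f (Suc m) = 0"
    by (metis coeff_eq_0 degree_0 eq_zero_or_degree_less le_SucE le_SucI le_imp_less_Suc
        less_Suc_eq_le zero_le)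
  then show ?thesis by (auto simp: annihilators_def le_Suc_eq)
qed

text \<open>Both sides equal \<open>\<Sum>i l. f\<^sub>i g\<^sub>l x(i + l + N + 1 - m)\<close>: summing over \<open>i\<close> first
  (over \<open>l\<close> first), only \<open>l = m\<close> (only \<open>i = m\<close>) contributes. The entry \<open>x(m + N + 1)\<close> lies beyond
  the given sequence; its value is irrelevant.\<close>

lemma annihilators_cross:
  assumes f: "f \<in> annihilators m N x" and g: "g \<in> annihilators m N x" and "m \<le> Suc N"
  shows "coeff g m * (\<Sum>i\<le>m. coeff f i * x (i + Suc N)) = coeff f m * (\<Sum>i\<le>m. coeff g i * x (i + Suc N))"
proof -
  define T where "T = (\<lambda>(f::'a poly) (g::'a poly).
    \<Sum>l\<le>m. coeff g l * (\<Sum>i\<le>m. coeff f i * x (i + (l + Suc N - m))))"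
  have T: "T f g = coeff g m * (\<Sum>i\<le>m. coeff f i * x (i + Suc N))"
    if f: "f \<in> annihilators m N x" for f g
  proof -
    have "T f g = (\<Sum>l\<in>{m}. coeff g l * (\<Sum>i\<le>m. coeff f i * x (i + (l + Suc N - m))))"
      unfolding T_def
    proof (rule sum.mono_neutral_right)
      show "\<forall>l\<in>{..m} - {m}. coeff g l * (\<Sum>i\<le>m. coeff f i * x (i + (l + Suc N - m))) = 0"
      proof
        fix l assume "l \<in> {..m} - {m}"
        then have "l + Suc N - m \<le> N" by auto
        with f have "(\<Sum>i\<le>m. coeff f i * x (i + (l + Suc N - m))) = 0"
          unfolding annihilators_def by blast
        then show "coeff g l * (\<Sum>i\<le>m. coeff f i * x (i + (l + Suc N - m))) = 0" by simp
      qed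
    qed auto
    then show ?thesis by simp
  qed
  have "T f g = (\<Sum>l\<le>m. \<Sum>i\<le>m. coeff g l * (coeff f i * x (i + l + Suc N - m)))"
    unfolding T_def sum_distrib_left using assms(3) by (simp add: add.assoc)
  also have "\<dots> = (\<Sum>i\<le>m. \<Sum>l\<le>m. coeff g l * (coeff f i * x (i + l + Suc N - m)))"
    by (rule sum.swap)
  also have "\<dots> = T g f"
    unfolding T_def sum_distrib_left using assms(3)
    by (intro sum.cong refl) (simp add: algebra_simps)
  finally show ?thesis using T[OF f, of g] T[OF g, of f] by simp
qed

text \<open>Take a nonzero annihilator of largest degree. If it lay in the smaller space, its
  product with the variable would be an annihilator of larger degree.\<close>

lemma exists_annihilator_not_lower:
  assumes "annihilators (Suc m) N x \<noteq> {0}"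
  obtains f where "f \<in> annihilators (Suc m) N x" "f \<notin> annihilators m (Suc N) x"
proof -
  define P where "P = (\<lambda>f. f \<noteq> 0 \<and> f \<in> annihilators (Suc m) N x)"
  obtain f where "P f" using assms zero_in_annihilators[of "Suc m" N x] by (auto simp: P_def)
  moreover have "\<forall>f. P f \<longrightarrow> degree f < Suc (Suc m)" by (auto simp: P_def annihilators_def)
  ultimately obtain f where f: "P f" "\<And>g. P g \<Longrightarrow> degree g \<le> degree f"
    using ex_has_greatest_nat[of P f degree "Suc (Suc m)"] by auto
  have "f \<notin> annihilators m (Suc N) x"
  proof
    assume "f \<in> annihilators m (Suc N) x"
    then have "P (pCons 0 f)" using f(1) annihilators_pCons_0 by (auto simp: P_def)
    from f(2)[OF this] show False using f(1) by (simp add: P_def)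
  qed
  with f(1) that show thesis by (auto simp: P_def)
qed

text \<open>By \<open>annihilators_cross\<close> the two functionals of
  \<open>annihilators_Suc_iff\<close> are proportional on the larger space, and by
  \<open>exists_annihilator_not_lower\<close> they do not both vanish there. So the smaller space
  has codimension one, with complement spanned by \<open>f0\<close>.\<close>

lemma card_annihilators_Suc:
  fixes x :: "nat \<Rightarrow> 'a::{field,finite}"
  assumes nz: "annihilators (Suc m) N x \<noteq> {0}" and "m \<le> N"
  shows "card (annihilators (Suc m) N x) = CARD('a) * card (annihilators m (Suc N) x)"
proof -
  let ?A = "annihilators (Suc m) N x" and ?B = "annihilators m (Suc N) x"
  define \<phi> where "\<phi> = (\<lambda>f. \<Sum>i\<le>Suc m. coeff f i * x (i + Suc N))"
  have B: "f \<in> ?B \<longleftrightarrow> f \<in> ?A \<and> coeff f (Suc m) = 0 \<and> \<phi> f = 0" for f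
    unfolding \<phi>_def by (rule annihilators_Suc_iff)
  obtain f0 where f0: "f0 \<in> ?A" "f0 \<notin> ?B"
    using exists_annihilator_not_lower[OF nz] .
  have \<phi>: "\<phi> (f - smult c g) = \<phi> f - c * \<phi> g" for f g c
    by (simp add: \<phi>_def algebra_simps sum_subtractf sum_distrib_left del: sum.atMost_Suc)
  have "bij_betw (\<lambda>(c, f). smult c f0 + f) (UNIV \<times> ?B) ?A"
  proof (rule bij_betwI')
    fix y z :: "'a \<times> 'a poly" assume "y \<in> UNIV \<times> ?B" "z \<in> UNIV \<times> ?B"
    then obtain c f d g where yz: "y = (c, f)" "z = (d, g)" and fg: "f \<in> ?B" "g \<in> ?B" by auto
    have "c = d \<and> f = g" if eq: "smult c f0 + f = smult d f0 + g"
    proof -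
      have "smult (c - d) f0 = g - f"
        using eq by (simp add: smult_diff_left algebra_simps)
      then have "smult (c - d) f0 \<in> ?B" using annihilators_diff[OF fg(2,1)] by simp
      \<comment> \<open>If \<open>c\<close> and \<open>d\<close> differed, rescaling would put
        \<open>f0\<close> itself into the smaller space.\<close>
      then have "smult (inverse (c - d)) (smult (c - d) f0) \<in> ?B" by (rule annihilators_smult)
      with f0(2) have "c = d" by (cases "c = d") auto
      with eq show ?thesis by simp
    qed
    then show "((\<lambda>(c, f). smult c f0 + f) y = (\<lambda>(c, f). smult c f0 + f) z) = (y = z)"
      unfolding yz by auto
  next
    fix y :: "'a \<times> 'a poly" assume "y \<in> UNIV \<times> ?B"
    then show "(\<lambda>(c, f). smult c f0 + f) y \<in> ?A"
      using annihilators_add[OF annihilators_smult[OF f0(1)]] B by auto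
  next
    fix f assume f: "f \<in> ?A"
    have cross: "coeff f0 (Suc m) * \<phi> f = coeff f (Suc m) * \<phi> f0"
      unfolding \<phi>_def using annihilators_cross[OF f f0(1)] \<open>m \<le> N\<close> by simp
    \<comment> \<open>Whichever functional is nonzero at \<open>f0\<close> determines
      \<open>c\<close> as a quotient; \<open>cross\<close> then yields the equation for the other
      one.\<close>
    have "coeff f0 (Suc m) \<noteq> 0 \<or> \<phi> f0 \<noteq> 0" using f0 B by auto
    then obtain c where c: "coeff f (Suc m) = c * coeff f0 (Suc m)" "\<phi> f = c * \<phi> f0"
    proof
      assume "coeff f0 (Suc m) \<noteq> 0"
      then show thesis
        using cross by (intro that[of "coeff f (Suc m) / coeff f0 (Suc m)"]) (auto simp: field_simps)
    next
      assume "\<phi> f0 \<noteq> 0"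
      then show thesis
        using cross by (intro that[of "\<phi> f / \<phi> f0"]) (auto simp: field_simps)
    qed
    have "f - smult c f0 \<in> ?A" using f f0(1) annihilators_diff annihilators_smult by blast
    then have "f - smult c f0 \<in> ?B" unfolding B by (simp add: \<phi> c)
    then show "\<exists>y\<in>UNIV \<times> ?B. f = (\<lambda>(c, f). smult c f0 + f) y"
      by (intro bexI[of _ "(c, f - smult c f0)"]) auto
  qed
  then show ?thesis
    using bij_betw_same_card by (fastforce simp: card_cartesian_product)
qed

lemma hankel_set_iff_annihilators:
  fixes x :: "nat \<Rightarrow> 'a::field"
  assumes "x \<in> {..n} \<rightarrow>\<^sub>E UNIV"
  shows "x \<in> hankel_set m n \<longleftrightarrow> annihilators m (n - m) x \<noteq> {0}"
proof
  assume "x \<in> hankel_set m n"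
  then obtain a where a: "\<exists>i\<le>m. a i \<noteq> 0" "\<forall>j\<le>n - m. (\<Sum>i\<le>m. a i * x (i + j)) = 0"
    by (auto simp: hankel_set_def)
  have "restrict a {..m} \<in> {..m} \<rightarrow>\<^sub>E (UNIV :: 'a set)" by auto
  then obtain f where f: "degree f \<le> m" "restrict a {..m} = restrict (coeff f) {..m}"
    using bij_betw_imp_surj_on[OF bij_betw_coeff_PiE[where 'a = 'a and d = m]] by blast
  have co: "coeff f i = a i" if "i \<le> m" for i
    using fun_cong[OF f(2), of i] that by simp
  then have "f \<in> annihilators m (n - m) x"
    using f(1) a(2) by (simp add: annihilators_def)
  moreover have "f \<noteq> 0" using a(1) co by auto
  ultimately show "annihilators m (n - m) x \<noteq> {0}" by blast
next
  assume "annihilators m (n - m) x \<noteq> {0}"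
  then obtain f where f: "f \<in> annihilators m (n - m) x" "f \<noteq> 0"
    using zero_in_annihilators[of m "n - m" x] by blast
  then have "coeff f (degree f) \<noteq> 0" "degree f \<le> m" by (auto simp: annihilators_def)
  then show "x \<in> hankel_set m n"
    using assms f(1) unfolding hankel_set_def annihilators_def by blast
qed

text \<open>If only zero annihilates, both cardinalities are 1 and the right side is 0; otherwise
  the two cardinality terms cancel. This makes the event linear in counts whose expectations can be
  computed by characters.\<close>

lemma hankel_set_indicator:
  fixes x :: "nat \<Rightarrow> 'a::{field,finite}"
  assumes "x \<in> {..n} \<rightarrow>\<^sub>E UNIV" and n: "n = Suc m + N" and "m \<le> N"
  shows "(real CARD('a) - 1) * indicator (hankel_set (Suc m) n) x =
    real (card (annihilators (Suc m) N x)) - real CARD('a) * real (card (annihilators m (Suc N) x))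
    + (real CARD('a) - 1)"
proof -
  have iff: "x \<in> hankel_set (Suc m) n \<longleftrightarrow> annihilators (Suc m) N x \<noteq> {0}"
    using hankel_set_iff_annihilators[OF assms(1), of "Suc m"] unfolding n by simp
  show ?thesis
  proof (cases "annihilators (Suc m) N x = {0}")
    case True
    have "annihilators m (Suc N) x \<subseteq> {0}"
      using annihilators_Suc_iff[of _ m N x] unfolding True by blast
    then have "annihilators m (Suc N) x = {0}"
      using zero_in_annihilators[of m "Suc N" x] by blast
    then show ?thesis using True iff by simp
  next
    case False
    then show ?thesis
      using card_annihilators_Suc[OF False \<open>m \<le> N\<close>] iff by simp
  qed
qed

section \<open>Characters\<close>

lemma nontrivial_character_0:
  assumes "nontrivial_character \<psi>"
  shows "\<psi> 0 = 1"
proof -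
  have "\<psi> (0 + 0) = \<psi> 0 * \<psi> 0" "norm (\<psi> 0) = 1"
    using assms unfolding nontrivial_character_def by blast+
  then show ?thesis by auto
qed

lemma nontrivial_character_sum:
  assumes "nontrivial_character \<psi>" "finite A"
  shows "\<psi> (\<Sum>i\<in>A. f i) = (\<Prod>i\<in>A. \<psi> (f i))"
  using assms(2)
proof (induction rule: finite_induct)
  case empty
  then show ?case using nontrivial_character_0[OF assms(1)] by simp
next
  case (insert a A)
  then show ?case using assms(1) by (simp add: nontrivial_character_def)
qed

text \<open>For nonzero \<open>y\<close> the argument runs over the whole field, and translation by
  some \<open>c\<close> with \<open>\<psi> c \<noteq> 1\<close> multiplies the sum by
  \<open>\<psi> c\<close>.\<close>

lemma sum_nontrivial_character:
  fixes \<psi> :: "'a::{field,finite} \<Rightarrow> complex"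
  assumes "nontrivial_character \<psi>"
  shows "(\<Sum>a\<in>UNIV. \<psi> (a * y)) = (if y = 0 then of_nat CARD('a) else 0)"
proof (cases "y = 0")
  case True
  then show ?thesis using nontrivial_character_0[OF assms] by simp
next
  case False
  from assms obtain c where c: "\<psi> c \<noteq> 1" and add: "\<And>x z. \<psi> (x + z) = \<psi> x * \<psi> z"
    unfolding nontrivial_character_def by blast
  have shift: "(\<Sum>a\<in>UNIV. \<psi> (a * y)) = (\<Sum>a\<in>UNIV. \<psi> a)"
    by (rule sum.reindex_bij_witness[of _ "\<lambda>a. a / y" "\<lambda>a. a * y"]) (use False in auto)
  have "(\<Sum>a\<in>UNIV. \<psi> a) = (\<Sum>a\<in>UNIV. \<psi> (c + a))"
    by (rule sum.reindex_bij_witness[of _ "\<lambda>a. c + a" "\<lambda>a. a - c"]) auto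
  also have "\<dots> = \<psi> c * (\<Sum>a\<in>UNIV. \<psi> a)" by (simp add: add sum_distrib_left)
  finally have "(\<Sum>a\<in>UNIV. \<psi> a) = 0" using c by auto
  with shift show ?thesis using False by simp
qed

text \<open>Sorting by \<open>k = i + j\<close> shows that the pairing of \<open>g\<close> and
  \<open>b\<close> against \<open>x\<close> depends on the product \<open>g * b\<close> alone. Index
  pairs outside the rectangle have a vanishing coefficient.\<close>

lemma sum_coeff_mult:
  fixes g b :: "'a::comm_ring_1 poly"
  assumes "degree g \<le> m" "degree b \<le> N"
  shows "(\<Sum>k\<le>m + N. coeff (g * b) k * x k) = (\<Sum>j\<le>N. coeff b j * (\<Sum>i\<le>m. coeff g i * x (i + j)))"
proof -
  let ?t = "\<lambda>i j. coeff g i * coeff b j * x (i + j)"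
  have "(\<Sum>k\<le>m + N. coeff (g * b) k * x k) = (\<Sum>k\<le>m + N. \<Sum>i\<le>k. ?t i (k - i))"
    by (simp add: coeff_mult sum_distrib_right)
  also have "\<dots> = (\<Sum>(i, j)\<in>{(i, j). i + j \<le> m + N}. ?t i j)"
    by (rule sum.triangle_reindex_eq[symmetric])
  also have "\<dots> = (\<Sum>(i, j)\<in>{..m} \<times> {..N}. ?t i j)"
  proof (rule sum.mono_neutral_right)
    show "finite {(i, j). i + j \<le> m + N}"
      by (rule finite_subset[of _ "{..m + N} \<times> {..m + N}"]) auto
    show "\<forall>z\<in>{(i, j). i + j \<le> m + N} - {..m} \<times> {..N}. (case z of (i, j) \<Rightarrow> ?t i j) = 0"
    proof
      fix z assume "z \<in> {(i, j). i + j \<le> m + N} - {..m} \<times> {..N}"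
      then obtain i j where "z = (i, j)" "i > m \<or> j > N" by (cases z) auto
      then show "(case z of (i, j) \<Rightarrow> ?t i j) = 0" using assms by (auto simp: coeff_eq_0)
    qed
  qed auto
  also have "\<dots> = (\<Sum>i\<le>m. \<Sum>j\<le>N. ?t i j)" by (rule sum.cartesian_product[symmetric])
  also have "\<dots> = (\<Sum>j\<le>N. \<Sum>i\<le>m. ?t i j)" by (rule sum.swap)
  also have "\<dots> = (\<Sum>j\<le>N. coeff b j * (\<Sum>i\<le>m. coeff g i * x (i + j)))"
    by (simp add: sum_distrib_left mult_ac)
  finally show ?thesis .
qed

text \<open>For fixed \<open>g\<close> the sum over \<open>b\<close> factors into one character sum
  per equation, each detecting whether that equation holds.\<close>

lemma card_annihilators_character_sum:
  fixes \<psi> :: "'a::{field,finite} \<Rightarrow> complex"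
  assumes \<psi>: "nontrivial_character \<psi>"
  shows "of_nat (CARD('a) ^ (N + 1)) * of_nat (card (annihilators m N x)) =
    (\<Sum>g | degree g \<le> m. \<Sum>b | degree b \<le> N. \<psi> (\<Sum>k\<le>m + N. coeff (g * b) k * x k))"
proof -
  have inner: "(\<Sum>b | degree b \<le> N. \<psi> (\<Sum>k\<le>m + N. coeff (g * b) k * x k))
    = (if g \<in> annihilators m N x then of_nat (CARD('a) ^ (N + 1)) else 0)"
    if g: "degree g \<le> m" for g
  proof -
    define y where "y j = (\<Sum>i\<le>m. coeff g i * x (i + j))" for j
    have "(\<Sum>b | degree b \<le> N. \<psi> (\<Sum>k\<le>m + N. coeff (g * b) k * x k))
      = (\<Sum>b | degree b \<le> N. \<Prod>j\<le>N. \<psi> (coeff b j * y j))"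
      by (intro sum.cong refl)
        (simp add: y_def sum_coeff_mult[OF g] nontrivial_character_sum[OF \<psi>, symmetric])
    also have "\<dots> = (\<Prod>j\<le>N. \<Sum>a\<in>UNIV. \<psi> (a * y j))"
      by (rule sum_degree_le_prod_coeff[where F = "\<lambda>j a. \<psi> (a * y j)"])
    also have "\<dots> = (\<Prod>j\<le>N. if y j = 0 then of_nat CARD('a) else 0)"
      by (simp only: sum_nontrivial_character[OF \<psi>])
    also have "\<dots> = (if \<forall>j\<le>N. y j = 0 then of_nat (CARD('a) ^ (N + 1)) else 0)"
      by (auto intro!: prod_zero)
    also have "(\<forall>j\<le>N. y j = 0) \<longleftrightarrow> g \<in> annihilators m N x"
      using g by (simp add: annihilators_def y_def)
    finally show ?thesis .
  qed
  have "(\<Sum>g | degree g \<le> m. \<Sum>b | degree b \<le> N. \<psi> (\<Sum>k\<le>m + N. coeff (g * b) k * x k))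
      = (\<Sum>g | degree g \<le> m. if g \<in> annihilators m N x then of_nat (CARD('a) ^ (N + 1)) else 0)"
    by (intro sum.cong refl inner) simp
  also have "\<dots> = (\<Sum>g\<in>annihilators m N x. of_nat (CARD('a) ^ (N + 1)))"
    by (rule sum.mono_neutral_cong_right) (auto simp: finite_degree_le annihilators_def)
  finally show ?thesis by (simp add: mult.commute)
qed

section \<open>The expected number of annihilators\<close>

text \<open>The mass that \<open>iid_pmf\<close> gives to a sequence, as an explicit product, so
  that expectations become finite sums.\<close>

definition iid_weight :: "'a pmf \<Rightarrow> nat \<Rightarrow> (nat \<Rightarrow> 'a) \<Rightarrow> real" where
  "iid_weight \<mu> n x = (\<Prod>k\<le>n. pmf \<mu> (x k))"

lemma sum_iid_weight:
  "(\<Sum>x\<in>{..n} \<rightarrow>\<^sub>E UNIV. iid_weight (\<mu> :: 'a::finite pmf) n x) = 1"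
proof -
  have "(\<Sum>x\<in>{..n} \<rightarrow>\<^sub>E UNIV. iid_weight \<mu> n x) = (\<Prod>k\<le>n. \<Sum>a\<in>UNIV. pmf \<mu> a)"
    unfolding iid_weight_def by (rule prod_sum_PiE[symmetric]) auto
  also have "(\<Sum>a\<in>UNIV. pmf \<mu> a) = 1" by (rule sum_pmf_eq_1) auto
  finally show ?thesis by simp
qed

lemma prob_iid_pmf:
  fixes \<mu> :: "'a::finite pmf"
  assumes "A \<subseteq> {..n} \<rightarrow>\<^sub>E UNIV"
  shows "measure_pmf.prob (iid_pmf \<mu> n) A = (\<Sum>x\<in>{..n} \<rightarrow>\<^sub>E UNIV. iid_weight \<mu> n x * indicator A x)"
proof -
  have fin: "finite ({..n} \<rightarrow>\<^sub>E (UNIV::'a set))" by (simp add: finite_PiE)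
  have "measure_pmf.prob (iid_pmf \<mu> n) A = (\<Sum>x\<in>A. pmf (iid_pmf \<mu> n) x)"
    using finite_subset[OF assms fin] by (rule measure_measure_pmf_finite)
  also have "\<dots> = (\<Sum>x\<in>A. iid_weight \<mu> n x)"
    unfolding iid_pmf_def iid_weight_def
    by (intro sum.cong refl pmf_Pi') (use assms in \<open>auto simp: PiE_def extensional_def\<close>)
  also have "\<dots> = (\<Sum>x\<in>{..n} \<rightarrow>\<^sub>E UNIV. iid_weight \<mu> n x * indicator A x)"
    using fin assms by (intro sum.mono_neutral_cong_left) auto
  finally show ?thesis .
qed

text \<open>Independence of the entries: the Fourier transform of a product distribution is the
  product of the transforms.\<close>

lemma sum_iid_weight_character:
  fixes \<psi> :: "'a::{field,finite} \<Rightarrow> complex"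
  assumes \<psi>: "nontrivial_character \<psi>"
  shows "(\<Sum>x\<in>{..n} \<rightarrow>\<^sub>E UNIV. of_real (iid_weight \<mu> n x) * \<psi> (\<Sum>k\<le>n. h k * x k))
    = (\<Prod>k\<le>n. fourier \<psi> \<mu> (h k))"
proof -
  have "(\<Prod>k\<le>n. fourier \<psi> \<mu> (h k))
      = (\<Sum>x\<in>{..n} \<rightarrow>\<^sub>E UNIV. \<Prod>k\<le>n. of_real (pmf \<mu> (x k)) * \<psi> (h k * x k))"
    unfolding fourier_def by (rule prod_sum_PiE) auto
  also have "\<dots> = (\<Sum>x\<in>{..n} \<rightarrow>\<^sub>E UNIV. of_real (iid_weight \<mu> n x) * \<psi> (\<Sum>k\<le>n. h k * x k))"
    by (simp add: nontrivial_character_sum[OF \<psi>] iid_weight_def prod.distrib)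
  finally show ?thesis by simp
qed

lemma fourier_0: "nontrivial_character \<psi> \<Longrightarrow> fourier \<psi> \<mu> 0 = 1"
proof -
  assume "nontrivial_character \<psi>"
  then have "fourier \<psi> \<mu> 0 = of_real (\<Sum>x\<in>UNIV. pmf \<mu> x)"
    by (simp add: fourier_def nontrivial_character_0)
  also have "(\<Sum>x\<in>UNIV. pmf \<mu> x) = 1" by (rule sum_pmf_eq_1) auto
  finally show ?thesis by simp
qed

lemma fourier_norm1_ge_1:
  assumes "nontrivial_character \<psi>"
  shows "fourier_norm1 \<psi> \<mu> \<ge> 1"
proof -
  have "norm (fourier \<psi> \<mu> 0) \<le> fourier_norm1 \<psi> \<mu>"
    unfolding fourier_norm1_def by (rule member_le_sum) auto
  then show ?thesis using fourier_0[OF assms] by simp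
qed

definition expected_annihilators :: "'a::{field,finite} pmf \<Rightarrow> nat \<Rightarrow> nat \<Rightarrow> real" where
  "expected_annihilators \<mu> m N =
     (\<Sum>x\<in>{..m + N} \<rightarrow>\<^sub>E UNIV. iid_weight \<mu> (m + N) x * real (card (annihilators m N x)))"

lemma expected_annihilators_fourier:
  fixes \<psi> :: "'a::{field,finite} \<Rightarrow> complex"
  assumes \<psi>: "nontrivial_character \<psi>"
  shows "of_real (real CARD('a) ^ (N + 1) * expected_annihilators \<mu> m N) =
    (\<Sum>(g, b)\<in>{g. degree g \<le> m} \<times> {b. degree b \<le> N}. \<Prod>k\<le>m + N. fourier \<psi> \<mu> (coeff (g * b) k))"
proof -
  let ?\<Omega> = "{..m + N} \<rightarrow>\<^sub>E (UNIV :: 'a set)" and ?w = "\<lambda>x. complex_of_real (iid_weight \<mu> (m + N) x)"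
  have "of_real (real CARD('a) ^ (N + 1) * expected_annihilators \<mu> m N) =
    (\<Sum>x\<in>?\<Omega>. ?w x * (of_nat (CARD('a) ^ (N + 1)) * of_nat (card (annihilators m N x))))"
    by (simp add: expected_annihilators_def sum_distrib_left mult_ac)
  also have "\<dots> = (\<Sum>x\<in>?\<Omega>. ?w x * (\<Sum>(g, b)\<in>{g. degree g \<le> m} \<times> {b. degree b \<le> N}.
      \<psi> (\<Sum>k\<le>m + N. coeff (g * b) k * x k)))"
    by (simp only: card_annihilators_character_sum[OF \<psi>] sum.cartesian_product)
  also have "\<dots> = (\<Sum>x\<in>?\<Omega>. \<Sum>(g, b)\<in>{g. degree g \<le> m} \<times> {b. degree b \<le> N}.
      ?w x * \<psi> (\<Sum>k\<le>m + N. coeff (g * b) k * x k))"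
    by (simp add: sum_distrib_left split_def)
  also have "\<dots> = (\<Sum>z\<in>{g. degree g \<le> m} \<times> {b. degree b \<le> N}. \<Sum>x\<in>?\<Omega>.
      (case z of (g, b) \<Rightarrow> ?w x * \<psi> (\<Sum>k\<le>m + N. coeff (g * b) k * x k)))"
    by (rule sum.swap)
  also have "\<dots> = (\<Sum>(g, b)\<in>{g. degree g \<le> m} \<times> {b. degree b \<le> N}.
      \<Prod>k\<le>m + N. fourier \<psi> \<mu> (coeff (g * b) k))"
    by (intro sum.cong refl) (auto simp: split_def sum_iid_weight_character[OF \<psi>])
  finally show ?thesis .
qed

text \<open>One of the two factors must vanish; the added 1 accounts for the pair
  \<open>(0, 0)\<close>, counted on both sides of the union.\<close>

lemma card_zero_product_pairs:
  "card {(g, b). degree (g :: 'a::{field,finite} poly) \<le> m \<and> degree b \<le> N \<and> g * b = 0} + 1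
    = CARD('a) ^ (m + 1) + CARD('a) ^ (N + 1)"
proof -
  let ?G = "{g::'a poly. degree g \<le> m}" and ?B = "{b::'a poly. degree b \<le> N}"
  have "{(g, b). degree (g :: 'a poly) \<le> m \<and> degree b \<le> N \<and> g * b = 0} = ?G \<times> {0} \<union> {0} \<times> ?B"
    by auto
  moreover have "card (?G \<times> {0} \<union> {0} \<times> ?B) + card (?G \<times> {0} \<inter> {0} \<times> ?B)
      = card (?G \<times> {0::'a poly}) + card ({0::'a poly} \<times> ?B)"
    by (intro card_Un_Int[symmetric]) (simp_all add: finite_degree_le)
  moreover have "?G \<times> {0} \<inter> {0} \<times> ?B = {(0, 0)}" by auto
  ultimately show ?thesis by (simp add: card_cartesian_product card_degree_le)
qed

text \<open>Each pair with zero product contributes 1 to the Fourier expansion, which gives the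
  subtracted main term; all other pairs form the error.\<close>

lemma expected_annihilators_approx:
  fixes \<psi> :: "'a::{field,finite} \<Rightarrow> complex"
  assumes \<psi>: "nontrivial_character \<psi>" and "B \<ge> 0"
    and B: "\<And>h::'a poly. h \<noteq> 0 \<Longrightarrow> degree h \<le> m + N \<Longrightarrow> real (card {g. g dvd h}) \<le> B"
  shows "\<bar>real CARD('a) ^ (N + 1) * expected_annihilators \<mu> m N
      - (real CARD('a) ^ (m + 1) + real CARD('a) ^ (N + 1) - 1)\<bar>
    \<le> B * fourier_norm1 \<psi> \<mu> ^ (m + N + 1)"
proof -
  define F where "F = (\<lambda>h. \<Prod>k\<le>m + N. fourier \<psi> \<mu> (coeff h k))"
  let ?P = "{g::'a poly. degree g \<le> m} \<times> {b::'a poly. degree b \<le> N}"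
  let ?H = "{h::'a poly. degree h \<le> m + N}"
  define Z where "Z = {(g, b). degree (g :: 'a poly) \<le> m \<and> degree b \<le> N \<and> g * b = 0}"
  have finP: "finite ?P" by (simp add: finite_degree_le)
  have ZP: "Z \<subseteq> ?P" by (auto simp: Z_def)
  have F0: "F 0 = 1" by (simp add: F_def fourier_0[OF \<psi>])
  have "of_real (real CARD('a) ^ (N + 1) * expected_annihilators \<mu> m N) = (\<Sum>(g, b)\<in>?P. F (g * b))"
    unfolding F_def by (rule expected_annihilators_fourier[OF \<psi>])
  also have "\<dots> = (\<Sum>(g, b)\<in>?P - Z. F (g * b)) + (\<Sum>(g, b)\<in>Z. F (g * b))"
    by (rule sum.subset_diff[OF ZP finP])
  also have "(\<Sum>(g, b)\<in>Z. F (g * b)) = (\<Sum>z\<in>Z. 1)"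
    by (rule sum.cong) (auto simp: Z_def F0)
  also have "\<dots> = of_nat (card Z)" by simp
  also have "real (card Z) = real CARD('a) ^ (m + 1) + real CARD('a) ^ (N + 1) - 1"
    using arg_cong[OF card_zero_product_pairs[where 'a = 'a and m = m and N = N], of real]
    unfolding Z_def by simp
  then have "complex_of_nat (card Z) = of_real (real CARD('a) ^ (m + 1) + real CARD('a) ^ (N + 1) - 1)"
    by (metis of_real_of_nat_eq)
  finally have eq: "of_real (real CARD('a) ^ (N + 1) * expected_annihilators \<mu> m N
      - (real CARD('a) ^ (m + 1) + real CARD('a) ^ (N + 1) - 1)) = (\<Sum>(g, b)\<in>?P - Z. F (g * b))"
    by simp
  have "norm (\<Sum>(g, b)\<in>?P - Z. F (g * b)) \<le> (\<Sum>(g, b)\<in>?P - Z. norm (F (g * b)))"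
    by (rule order.trans[OF norm_sum]) (simp add: split_def)
  \<comment> \<open>The summand depends only on the product \<open>h\<close>, so the pairs are
    grouped by it.\<close>
  also have "\<dots> = (\<Sum>h\<in>?H - {0}. \<Sum>z\<in>{z. z \<in> ?P - Z \<and> fst z * snd z = h}. norm (F (fst z * snd z)))"
    unfolding split_def using finP
    by (intro sum.group[symmetric])
      (auto simp: Z_def finite_degree_le intro: order.trans[OF degree_mult_le])
  also have "\<dots> = (\<Sum>h\<in>?H - {0}. real (card {z. z \<in> ?P - Z \<and> fst z * snd z = h}) * norm (F h))"
    by (rule sum.cong) simp_all
  also have "\<dots> \<le> (\<Sum>h\<in>?H - {0}. B * norm (F h))"
  proof (intro sum_mono mult_right_mono)
    fix h assume h: "h \<in> ?H - {0}"
    have "card {z. z \<in> ?P - Z \<and> fst z * snd z = h} \<le> card {g. g dvd h}"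
    proof (rule card_inj_on_le[of fst])
      \<comment> \<open>Since \<open>h\<close> is nonzero, the first factor determines the second by
        cancellation.\<close>
      show "inj_on fst {z. z \<in> ?P - Z \<and> fst z * snd z = h}"
        using h by (auto simp: inj_on_def)
      show "finite {g. g dvd h}" using h by (intro finite_poly_divisors) auto
    qed auto
    also have "real (card {g. g dvd h}) \<le> B" using h by (intro B) auto
    finally show "real (card {z. z \<in> ?P - Z \<and> fst z * snd z = h}) \<le> B" by simp
  qed auto
  \<comment> \<open>Restoring \<open>h = 0\<close> makes the sum range over all coefficient vectors,
    so that it factors.\<close>
  also have "\<dots> \<le> (\<Sum>h\<in>?H. B * norm (F h))"
    using \<open>B \<ge> 0\<close> by (intro sum_mono2) (auto simp: finite_degree_le)
  also have "\<dots> = B * (\<Sum>h | degree h \<le> m + N. \<Prod>k\<le>m + N. norm (fourier \<psi> \<mu> (coeff h k)))"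
    by (simp add: sum_distrib_left F_def prod_norm)
  also have "\<dots> = B * fourier_norm1 \<psi> \<mu> ^ (m + N + 1)"
    using sum_degree_le_prod_coeff[where F = "\<lambda>_ a. norm (fourier \<psi> \<mu> a)" and d = "m + N"]
    by (simp add: fourier_norm1_def)
  finally show ?thesis
    unfolding eq[symmetric] by (simp only: norm_of_real)
qed



section \<open>The limit\<close>

lemma prob_hankel_set_approx:
  fixes \<psi> :: "'a::{field,finite} \<Rightarrow> complex"
  assumes \<psi>: "nontrivial_character \<psi>" and "B \<ge> 0"
    and B: "\<And>h::'a poly. h \<noteq> 0 \<Longrightarrow> degree h \<le> n \<Longrightarrow> real (card {g. g dvd h}) \<le> B"
    and n: "n = 2 * Suc m + \<alpha>"
  shows "\<bar>measure_pmf.prob (iid_pmf \<mu> n) (hankel_set (Suc m) n) - 1 / real CARD('a) ^ (\<alpha> + 1)\<bar>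
    \<le> 2 * B * fourier_norm1 \<psi> \<mu> ^ (n + 1) / real CARD('a) ^ (Suc m + \<alpha> + 1)"
proof -
  define q where "q = real CARD('a)"
  define N where "N = Suc m + \<alpha>"
  define P where "P = measure_pmf.prob (iid_pmf \<mu> n) (hankel_set (Suc m) n)"
  let ?S = "fourier_norm1 \<psi> \<mu>" and ?\<Omega> = "{..n} \<rightarrow>\<^sub>E (UNIV :: 'a set)"
  have "card {0, 1 :: 'a} \<le> CARD('a)" by (intro card_mono) auto
  then have q: "q \<ge> 2" by (simp add: q_def)
  \<comment> \<open>Both annihilator spaces concern sequences of the same length, so one sample
    space and one divisor bound serve both.\<close>
  have nN: "n = Suc m + N" "n = m + Suc N" "m \<le> N" using n by (auto simp: N_def)
  let ?E1 = "expected_annihilators \<mu> (Suc m) N" and ?E2 = "expected_annihilators \<mu> m (Suc N)"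
  have "(q - 1) * P = (\<Sum>x\<in>?\<Omega>. iid_weight \<mu> n x * ((q - 1) * indicator (hankel_set (Suc m) n) x))"
    unfolding P_def by (subst prob_iid_pmf) (auto simp: hankel_set_def sum_distrib_left mult_ac)
  also have "\<dots> = (\<Sum>x\<in>?\<Omega>. iid_weight \<mu> n x * (real (card (annihilators (Suc m) N x))
      - q * real (card (annihilators m (Suc N) x)) + (q - 1)))"
    unfolding q_def by (intro sum.cong refl) (simp only: hankel_set_indicator[OF _ nN(1,3)])
  also have "\<dots> = (\<Sum>x\<in>?\<Omega>. iid_weight \<mu> n x * real (card (annihilators (Suc m) N x)))
      - q * (\<Sum>x\<in>?\<Omega>. iid_weight \<mu> n x * real (card (annihilators m (Suc N) x)))
      + (q - 1) * (\<Sum>x\<in>?\<Omega>. iid_weight \<mu> n x)"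
    by (simp only: sum_distrib_left sum.distrib[symmetric] sum_subtractf[symmetric])
      (simp add: algebra_simps)
  also have "\<dots> = ?E1 - q * ?E2 + (q - 1)"
    unfolding expected_annihilators_def nN(1)[symmetric] nN(2)[symmetric] sum_iid_weight by simp
  finally have P: "(q - 1) * P = ?E1 - q * ?E2 + (q - 1)" .
  define R1 where "R1 = q ^ (N + 1) * ?E1 - (q ^ (Suc m + 1) + q ^ (N + 1) - 1)"
  define R2 where "R2 = q ^ (Suc N + 1) * ?E2 - (q ^ (m + 1) + q ^ (Suc N + 1) - 1)"
  have R1: "\<bar>R1\<bar> \<le> B * ?S ^ (n + 1)"
    unfolding R1_def q_def nN(1) by (rule expected_annihilators_approx[OF \<psi> \<open>B \<ge> 0\<close> B]) (simp_all add: nN(1))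
  have R2: "\<bar>R2\<bar> \<le> B * ?S ^ (n + 1)"
    unfolding R2_def q_def nN(2) by (rule expected_annihilators_approx[OF \<psi> \<open>B \<ge> 0\<close> B]) (simp_all add: nN(2))
  \<comment> \<open>The powers \<open>q ^ (N + 1)\<close> and \<open>q ^ (N + 2)\<close> and the
    constants cancel; what is left of the main terms is
    \<open>q ^ (m + 2) - q ^ (m + 1)\<close>.\<close>
  have "q ^ (N + 1) * ((q - 1) * P) = (q - 1) * q ^ (m + 1) + (R1 - R2)"
    unfolding P R1_def R2_def by (simp add: algebra_simps)
  moreover have "q ^ (N + 1) = q ^ (m + 1) * q ^ (\<alpha> + 1)"
    by (simp add: N_def power_add)
  then have "q ^ (N + 1) * (1 / q ^ (\<alpha> + 1)) = q ^ (m + 1)" using q by simp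
  moreover have "(q - 1) * X * (P - Y) = X * ((q - 1) * P) - (q - 1) * (X * Y)" for X Y
    by (simp add: algebra_simps)
  ultimately have "(q - 1) * q ^ (N + 1) * (P - 1 / q ^ (\<alpha> + 1)) = R1 - R2"
    by (simp only: add_diff_cancel_left')
  then have "\<bar>(q - 1) * q ^ (N + 1)\<bar> * \<bar>P - 1 / q ^ (\<alpha> + 1)\<bar> = \<bar>R1 - R2\<bar>"
    by (simp only: abs_mult[symmetric])
  moreover have "\<bar>(q - 1) * q ^ (N + 1)\<bar> = (q - 1) * q ^ (N + 1)"
    using q by (intro abs_of_nonneg mult_nonneg_nonneg zero_le_power) auto
  ultimately have "(q - 1) * q ^ (N + 1) * \<bar>P - 1 / q ^ (\<alpha> + 1)\<bar> = \<bar>R1 - R2\<bar>"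
    by (simp only:)
  also have "\<dots> \<le> 2 * B * ?S ^ (n + 1)" using R1 R2 by linarith
  finally have "(q - 1) * (q ^ (N + 1) * \<bar>P - 1 / q ^ (\<alpha> + 1)\<bar>) \<le> 2 * B * ?S ^ (n + 1)"
    by (simp add: mult.assoc)
  moreover have "1 * (q ^ (N + 1) * \<bar>P - 1 / q ^ (\<alpha> + 1)\<bar>) \<le> (q - 1) * (q ^ (N + 1) * \<bar>P - 1 / q ^ (\<alpha> + 1)\<bar>)"
    using q by (intro mult_right_mono) auto
  ultimately have "q ^ (N + 1) * \<bar>P - 1 / q ^ (\<alpha> + 1)\<bar> \<le> 2 * B * ?S ^ (n + 1)"
    by (simp only: mult_1)
  then have "\<bar>P - 1 / q ^ (\<alpha> + 1)\<bar> \<le> 2 * B * ?S ^ (n + 1) / q ^ (N + 1)"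
    using q by (subst pos_le_divide_eq) (auto simp: mult.commute)
  then show ?thesis by (simp add: P_def q_def N_def)
qed

lemma prob_hankel_set_tendsto:
  fixes \<mu> :: "'a::{field,finite} pmf"
  assumes \<psi>: "nontrivial_character \<psi>" and S: "fourier_norm1 \<psi> \<mu> < sqrt (real CARD('a))"
  shows "(\<lambda>m. measure_pmf.prob (iid_pmf \<mu> (2 * m + \<alpha>)) (hankel_set m (2 * m + \<alpha>)))
           \<longlonglongrightarrow> 1 / real CARD('a) ^ (\<alpha> + 1)"
proof -
  define q where "q = real CARD('a)"
  define s where "s = fourier_norm1 \<psi> \<mu>"
  have s: "s \<ge> 1" "s < sqrt q" using fourier_norm1_ge_1[OF \<psi>] S by (auto simp: s_def q_def)
  then have "1 < sqrt q / s" by simp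
  \<comment> \<open>The strict inequality on the norm leaves room for a divisor bound growing like
    \<open>u ^ n\<close> with \<open>u * s\<close> still below \<open>sqrt q\<close>.\<close>
  then obtain u where u: "1 < u" "u < sqrt q / s" using dense by blast
  \<comment> \<open>Raising \<open>m\<close> by one raises \<open>n\<close> by two and the exponent
    of \<open>q\<close> in the denominator by one, so \<open>r\<close> is the decay ratio of the
    error.\<close>
  define r where "r = (u * s)\<^sup>2 / q"
  have "0 < u * s" "u * s < sqrt q" using u s by (auto simp: field_simps)
  then have "(u * s)\<^sup>2 < (sqrt q)\<^sup>2" by (intro power_strict_mono) auto
  moreover have q: "q > 0" by (simp add: q_def)
  ultimately have r: "0 \<le> r" "r < 1" by (auto simp: r_def)
  obtain C where C: "C \<ge> 0"
    "\<And>h::'a poly. h \<noteq> 0 \<Longrightarrow> real (card {g. g dvd h}) \<le> C * (1 + (u - 1)) ^ degree h"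
    using card_poly_divisors_bound[of "u - 1", where 'a = 'a] u(1) by auto
  define K where "K = 2 * C * u ^ \<alpha> * s ^ (\<alpha> + 1) / q ^ (\<alpha> + 1)"
  have bound: "\<bar>measure_pmf.prob (iid_pmf \<mu> (2 * Suc m + \<alpha>)) (hankel_set (Suc m) (2 * Suc m + \<alpha>)) - 1 / q ^ (\<alpha> + 1)\<bar>
      \<le> K * r ^ Suc m" for m
  proof -
    let ?n = "2 * Suc m + \<alpha>"
    have "real (card {g. g dvd h}) \<le> C * u ^ ?n" if "h \<noteq> 0" "degree h \<le> ?n" for h :: "'a poly"
    proof -
      have "real (card {g. g dvd h}) \<le> C * u ^ degree h" using C(2)[OF that(1)] by simp
      also have "\<dots> \<le> C * u ^ ?n" using that(2) C(1) u(1) by (intro mult_left_mono power_increasing) auto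
      finally show ?thesis .
    qed
    from prob_hankel_set_approx[OF \<psi> _ this refl, where \<mu> = \<mu>]
    have "\<bar>measure_pmf.prob (iid_pmf \<mu> ?n) (hankel_set (Suc m) ?n) - 1 / q ^ (\<alpha> + 1)\<bar>
        \<le> 2 * (C * u ^ ?n) * s ^ (?n + 1) / q ^ (Suc m + \<alpha> + 1)"
      using C(1) u(1) by (simp add: q_def s_def)
    also have "\<dots> = K * r ^ Suc m"
    proof -
      have "?n = \<alpha> + 2 * Suc m" "?n + 1 = \<alpha> + 1 + 2 * Suc m" "Suc m + \<alpha> + 1 = \<alpha> + 1 + Suc m" by auto
      then show ?thesis
        by (simp only: K_def r_def power_add power_mult power_mult_distrib power_divide) simp
    qed
    finally show ?thesis .
  qed
  have "(\<lambda>m. K * r ^ Suc m) \<longlonglongrightarrow> K * 0"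
    by (intro tendsto_mult_left LIMSEQ_Suc LIMSEQ_power_zero) (use r in auto)
  then have lim: "(\<lambda>m. K * r ^ Suc m) \<longlonglongrightarrow> 0" by (simp only: mult_zero_right)
  have "(\<lambda>m. measure_pmf.prob (iid_pmf \<mu> (2 * Suc m + \<alpha>)) (hankel_set (Suc m) (2 * Suc m + \<alpha>))
      - 1 / q ^ (\<alpha> + 1)) \<longlonglongrightarrow> 0"
    by (rule Lim_null_comparison[OF _ lim], intro always_eventually allI, unfold real_norm_def, rule bound)
  then have "(\<lambda>m. measure_pmf.prob (iid_pmf \<mu> (2 * Suc m + \<alpha>)) (hankel_set (Suc m) (2 * Suc m + \<alpha>)))
      \<longlonglongrightarrow> 1 / q ^ (\<alpha> + 1)"
    by (rule LIM_zero_cancel)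
  then show ?thesis
    \<comment> \<open>The bound was derived at \<open>Suc m\<close>, because the codimension
      argument needs a space of degree bound one lower.\<close>
    unfolding q_def by - (rule LIMSEQ_imp_Suc)
qed

section \<open>Singular Hankel matrices\<close>

lemma invertible_mat_iff_det_nonzero:
  fixes A :: "'a::field mat"
  assumes A: "A \<in> carrier_mat n n"
  shows "invertible_mat A \<longleftrightarrow> det A \<noteq> 0"
proof
  assume "invertible_mat A"
  then obtain B where AB: "A * B = 1\<^sub>m n" and BA: "B * A = 1\<^sub>m (dim_row B)"
    using A by (auto simp: invertible_mat_def inverts_mat_def)
  \<comment> \<open>The definition of invertibility does not state the shape of \<open>B\<close>;
    comparing column counts in both identities shows that it is \<open>n\<close> by
    \<open>n\<close>.\<close>
  have "dim_col (A * B) = n" "dim_col (B * A) = dim_row B"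
    unfolding AB BA by simp_all
  then have "B \<in> carrier_mat n n" using A by auto
  from det_mult[OF A this] AB show "det A \<noteq> 0" by auto
next
  assume "det A \<noteq> 0"
  from det_non_zero_imp_unit[OF A this, of "()"]
  obtain B where "B \<in> carrier_mat n n" "B * A = 1\<^sub>m n" "A * B = 1\<^sub>m n"
    by (auto simp: Units_def ring_mat_def)
  then show "invertible_mat A"
    using A by (auto simp: invertible_mat_def inverts_mat_def)
qed

text \<open>For \<alpha> = 0 the equations in \<open>hankel_set\<close> say that \<open>a\<close>
  lies in the kernel of the matrix; its symmetry makes the side of multiplication
  immaterial.\<close>

lemma singular_hankel_mat_iff:
  fixes x :: "nat \<Rightarrow> 'a::field"
  assumes "x \<in> {..2 * m} \<rightarrow>\<^sub>E UNIV"
  shows "\<not> invertible_mat (hankel_mat m x) \<longleftrightarrow> x \<in> hankel_set m (2 * m)"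
proof -
  have H: "hankel_mat m x \<in> carrier_mat (m + 1) (m + 1)" by (simp add: hankel_mat_def)
  have mult: "hankel_mat m x *\<^sub>v v = 0\<^sub>v (m + 1) \<longleftrightarrow> (\<forall>j\<le>m. (\<Sum>i\<le>m. v $ i * x (i + j)) = 0)"
    if v: "v \<in> carrier_vec (m + 1)" for v
  proof -
    have "(hankel_mat m x *\<^sub>v v) $ j = (\<Sum>i\<le>m. v $ i * x (i + j))" if "j \<le> m" for j
      using that v by (simp add: hankel_mat_def scalar_prod_def atLeast0LessThan lessThan_Suc_atMost
          add.commute mult.commute)
    then show ?thesis
      using H by (auto simp: vec_eq_iff less_Suc_eq_le)
  qed
  have nz: "v \<noteq> 0\<^sub>v (m + 1) \<longleftrightarrow> (\<exists>i\<le>m. v $ i \<noteq> 0)" if "v \<in> carrier_vec (m + 1)" for v :: "'a vec"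
    using that by (auto simp: vec_eq_iff less_Suc_eq_le)
  have "\<not> invertible_mat (hankel_mat m x) \<longleftrightarrow>
    (\<exists>v\<in>carrier_vec (m + 1). (\<exists>i\<le>m. v $ i \<noteq> 0) \<and> (\<forall>j\<le>m. (\<Sum>i\<le>m. v $ i * x (i + j)) = 0))"
    using invertible_mat_iff_det_nonzero[OF H] det_0_iff_vec_prod_zero_field[OF H] mult nz by blast
  also have "\<dots> \<longleftrightarrow> (\<exists>a. (\<exists>i\<le>m. a i \<noteq> 0) \<and> (\<forall>j\<le>m. (\<Sum>i\<le>m. a i * x (i + j)) = 0))"
  proof (intro iffI; elim bexE exE)
    fix v :: "'a vec"
    assume "(\<exists>i\<le>m. v $ i \<noteq> 0) \<and> (\<forall>j\<le>m. (\<Sum>i\<le>m. v $ i * x (i + j)) = 0)"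
    then show "\<exists>a. (\<exists>i\<le>m. a i \<noteq> 0) \<and> (\<forall>j\<le>m. (\<Sum>i\<le>m. a i * x (i + j)) = 0)" by blast
  next
    fix a :: "nat \<Rightarrow> 'a"
    assume "(\<exists>i\<le>m. a i \<noteq> 0) \<and> (\<forall>j\<le>m. (\<Sum>i\<le>m. a i * x (i + j)) = 0)"
    then show "\<exists>v\<in>carrier_vec (m + 1). (\<exists>i\<le>m. v $ i \<noteq> 0) \<and> (\<forall>j\<le>m. (\<Sum>i\<le>m. v $ i * x (i + j)) = 0)"
      by (intro bexI[of _ "Matrix.vec (m + 1) a"]) (auto simp: less_Suc_eq_le)
  qed
  also have "\<dots> \<longleftrightarrow> x \<in> hankel_set m (2 * m)"
    using assms by (simp add: hankel_set_def mult_2)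
  finally show ?thesis .
qed

text \<open>The two sets can differ only at functions not \<open>undefined\<close> outside
  \<open>{..2 * m}\<close>, which \<open>iid_pmf\<close> gives mass zero.\<close>

lemma prob_singular_hankel_mat:
  "measure_pmf.prob (iid_pmf \<mu> (2 * m)) {x. \<not> invertible_mat (hankel_mat m x)}
    = measure_pmf.prob (iid_pmf \<mu> (2 * m)) (hankel_set m (2 * m))"
proof -
  have "set_pmf (iid_pmf \<mu> (2 * m)) \<subseteq> {..2 * m} \<rightarrow>\<^sub>E UNIV"
    using set_Pi_pmf_subset[of "{..2 * m}" undefined "\<lambda>_. \<mu>"]
    by (auto simp: iid_pmf_def PiE_def extensional_def)
  then have "{x. \<not> invertible_mat (hankel_mat m x)} \<inter> set_pmf (iid_pmf \<mu> (2 * m))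
      = hankel_set m (2 * m) \<inter> set_pmf (iid_pmf \<mu> (2 * m))"
    using singular_hankel_mat_iff by blast
  then show ?thesis by (metis measure_Int_set_pmf)
qed

theorem mainTheorem3:
  fixes \<mu> :: "'a::{field,finite} pmf" and \<psi>\<^sub>0 :: "'a \<Rightarrow> complex" and \<alpha> :: nat
  assumes "nontrivial_character \<psi>\<^sub>0"
    and "fourier_norm1 \<psi>\<^sub>0 \<mu> < sqrt (real CARD('a))"
  shows "((\<lambda>m. measure_pmf.prob (iid_pmf \<mu> (2 * m + \<alpha>)) (hankel_set m (2 * m + \<alpha>)))
           \<longlonglongrightarrow> 1 / real CARD('a) ^ (\<alpha> + 1))
       \<and> ((\<lambda>m. measure_pmf.prob (iid_pmf \<mu> (2 * m)) {x. \<not> invertible_mat (hankel_mat m x)})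
           \<longlonglongrightarrow> 1 / real CARD('a))"
  using prob_hankel_set_tendsto[OF assms, of \<alpha>] prob_hankel_set_tendsto[OF assms, of 0]
  by (simp only: prob_singular_hankel_mat add_0_right add_0 power_one_right simp_thms)

end
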